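(* Let $\Theta_1=\begin{pmatrix}\mathbb A_1&K_1&1\\ \mathcal H_+\subset\mathcal H\subset\mathcal H_-&&\mathbb C\end{pmatrix}$ be a minimal L-system whose main operator $T$ and the quasi-kernel $\hat A_1$ of $\mathrm{Re}\,\mathbb A_1$ satisfy the conditions of Hypothesis I, and let $\Theta_2=\begin{pmatrix}\mathbb A_2&K_2&1\\ \mathcal H_+\subset\mathcal H\subset\mathcal H_-&&\mathbb C\end{pmatrix}$ be another minimal L-system with the same operators $\dot A$ and $T$ as $\Theta_1$ but with the quasi-kernel $\hat A_2$ of $\mathrm{Re}\,\mathbb A_2$ that satisfies the conditions of Hypothesis II. Then $$W_{\Theta_1}(z)=-W_{\Theta_2}(z),\qquad z\in\mathbb C_+\cap\rho(T),$$ and $$V_{\Theta_1}(z)=-\frac1{V_{\Theta_2}(z)},\qquad z\in\mathbb C_+\cap\rho(T).$$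
   Context: Let $\dot A$ be a closed, densely defined symmetric operator with deficiency indices $(1,1)$ in a Hilbert space $\mathcal H$. Let $\mathcal H_+=\mathrm{Dom}(\dot A^* )$ with inner product $(f,g)_+=(f,g)+(\dot A^*f,\dot A^*g)$, and let $\mathcal H_+\subset\mathcal H\subset\mathcal H_-$ be the associated rigged Hilbert space ($\mathcal H_-$ is the dual of $\mathcal H_+$ with respect to the pairing extending the inner product of $\mathcal H$). For a bounded $\mathbb A:\mathcal H_+\to\mathcal H_-$ the adjoint $\mathbb A^*$ is again bounded $\mathcal H_+\to\mathcal H_-$; $\mathrm{Re}\,\mathbb A=(\mathbb A+\mathbb A^* )/2$, $\mathrm{Im}\,\mathbb A=(\mathbb A-\mathbb A^* )/(2i)$. An operator $T$ with $\dot A\subset T\subset\dot A^*$ belongs to the class $\Lambda(\dot A)$ if $\rho(T)\neq\emptyset$ and $\mathrm{Dom}(\dot A)=\mathrm{Dom}(T)\cap\mathrm{Dom}(T^* )$. A bounded $\mathbb A:\mathcal H_+\to\mathcal H_-$ is a $( * )$-extension of $T$ if $\mathbb A\supset T\supset\dot A$, $\mathbb A^*\supset T^*\supset\dot A$, and the quasi-kernel $\hat A$ of $\mathrm{Re}\,\mathbb A$, i.e. the restriction of $\mathrm{Re}\,\mathbb A$ to $\{f\in\mathcal H_+:\mathrm{Re}\,\mathbb A f\in\mathcal H\}$, is a self-adjoint operator in $\mathcal H$. An L-system (with input-output space $\mathbb C$ and $J=1$) is an array $\Theta=\begin{pmatrix}\mathbb A&K&1\\ \mathcal H_+\subset\mathcal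 H\subset\mathcal H_-&&\mathbb C\end{pmatrix}$, where $\mathbb A$ is a $( * )$-extension of some $T\in\Lambda(\dot A)$ and $K:\mathbb C\to\mathcal H_-$ is bounded with adjoint $K^*:\mathcal H_+\to\mathbb C$, $\mathrm{Im}\,\mathbb A=KK^*$, $\mathrm{Ran}(K)=\mathrm{Ran}(\mathrm{Im}\,\mathbb A)$. $T$ is the main operator. $\Theta$ is minimal if $\dot A$ is prime (there is no nontrivial reducing subspace on which $\dot A$ induces a self-adjoint operator). The transfer function is $W_\Theta(z)=1-2iK^*(\mathbb A-zI)^{-1}K$, $z\in\rho(T)$, and the impedance function is $V_\Theta(z)=K^*(\mathrm{Re}\,\mathbb A-zI)^{-1}K$, $z\in\rho(\hat A)$ (both are well defined). Hypothesis I (for $\dot A$, a maximal dissipative extension $T\ne T^*$ of $\dot A$, and a self-adjoint extension $A$ of $\dot A$): the deficiency elements $g_\pm\in\ker(\dot A^*\mp iI)$ are normalized, $\|g_\pm\|=1$, and chosen in such a way that $g_+-g_-\in\mathrm{Dom}(A)$ and $g_+-\kappa g_-\in\mathrm{Dom}(T)$ for some $\kappa$, $0\le\kappa<1$. Hypothesis II: the same with $g_++g_-\in\mathrm{Dom}(A)$ in place of $g_+-g_-\in\mathrm{Dom}(A)$. For an L-system these are applied with $A=\hat A$, the quasi-kernel of $\mathrm{Re}\,\mathbb A$. *)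

theory Defs
  imports "HOL-Analysis.Analysis"
begin

section \<open>Complex Hilbert spaces\<close>

text \<open>
  The complex structure is added on top of \<^class>\<open>real_inner\<close>, so that norm and topology are the
  ones of the library.  The inner product is linear in the first argument.
\<close>

class complex_hilbert = real_inner + complete_space +
  fixes scaleC :: "complex \<Rightarrow> 'a \<Rightarrow> 'a"  (infixr "*\<^sub>C" 75)
    and cinner :: "'a \<Rightarrow> 'a \<Rightarrow> complex"
  assumes scaleC_add_right: "c *\<^sub>C (x + y) = c *\<^sub>C x + c *\<^sub>C y"
    and scaleC_add_left: "(c + d) *\<^sub>C x = c *\<^sub>C x + d *\<^sub>C x"
    and scaleC_scaleC: "c *\<^sub>C d *\<^sub>C x = (c * d) *\<^sub>C x"
    and scaleC_one: "1 *\<^sub>C x = x"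
    and scaleR_scaleC: "r *\<^sub>R x = complex_of_real r *\<^sub>C x"
    and cinner_commute: "cinner x y = cnj (cinner y x)"
    and cinner_add_left: "cinner (x + y) z = cinner x z + cinner y z"
    and cinner_scaleC_left: "cinner (c *\<^sub>C x) y = c * cinner x y"
    and inner_eq_Re_cinner: "inner x y = Re (cinner x y)"

global_interpretation cvs: vector_space "scaleC :: complex \<Rightarrow> 'a \<Rightarrow> 'a::complex_hilbert"
  defines csubspace = cvs.subspace
    and cdim = cvs.dim
  by standard (simp_all add: scaleC_add_right scaleC_add_left scaleC_scaleC scaleC_one)

instantiation complex :: complex_hilbert
begin

definition scaleC_complex :: "complex \<Rightarrow> complex \<Rightarrow> complex"
  where "scaleC_complex c x = c * x"

definition cinner_complex :: "complex \<Rightarrow> complex \<Rightarrow> complex"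
  where "cinner_complex x y = x * cnj y"

instance
  by standard
    (simp_all add: scaleC_complex_def cinner_complex_def algebra_simps scaleR_conv_of_real
      inner_complex_def)

end

instantiation prod :: (complex_hilbert, complex_hilbert) complex_hilbert
begin

definition scaleC_prod :: "complex \<Rightarrow> 'a \<times> 'b \<Rightarrow> 'a \<times> 'b"
  where "scaleC_prod c p = (c *\<^sub>C fst p, c *\<^sub>C snd p)"

definition cinner_prod :: "'a \<times> 'b \<Rightarrow> 'a \<times> 'b \<Rightarrow> complex"
  where "cinner_prod p q = cinner (fst p) (fst q) + cinner (snd p) (snd q)"

instance
proof
  fix p q :: "'a \<times> 'b"
  show "cinner p q = cnj (cinner q p)"
    unfolding cinner_prod_def by (metis cinner_commute complex_cnj_add)
qed (simp_all add: scaleC_prod_def cinner_prod_def prod_eq_iff scaleC_add_right scaleC_add_left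
    scaleC_scaleC scaleC_one scaleR_scaleC cinner_add_left cinner_scaleC_left
    inner_prod_def inner_eq_Re_cinner algebra_simps)

end


section \<open>Unbounded operators\<close>

text \<open>
  An unbounded operator is identified with its graph; \<open>S \<subseteq> T\<close> then says that \<open>T\<close> extends \<open>S\<close>,
  \<^const>\<open>Domain\<close> is the domain, and closedness is closedness of a set in the product space.
\<close>

type_synonym 'a operator = "('a \<times> 'a) set"

definition linear_operator :: "'a::complex_hilbert operator \<Rightarrow> bool"
  where "linear_operator T \<longleftrightarrow> csubspace T \<and> single_valued T"

definition app :: "'a operator \<Rightarrow> 'a \<Rightarrow> 'a"
  where "app T f = (THE h. (f, h) \<in> T)"

definition densely_defined :: "'a::complex_hilbert operator \<Rightarrow> bool"
  where "densely_defined T \<longleftrightarrow> closure (Domain T) = UNIV"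

definition adjoint_op :: "'a::complex_hilbert operator \<Rightarrow> 'a operator"
  where "adjoint_op T = {(f, h). \<forall>(u, v) \<in> T. cinner v f = cinner u h}"

definition symmetric_op :: "'a::complex_hilbert operator \<Rightarrow> bool"
  where "symmetric_op T \<longleftrightarrow> linear_operator T \<and> densely_defined T \<and> T \<subseteq> adjoint_op T"

text \<open>Self-adjointness of an operator acting in the closed subspace \<open>M\<close>, itself a Hilbert space.\<close>

definition self_adjoint_in :: "'a::complex_hilbert set \<Rightarrow> 'a operator \<Rightarrow> bool"
  where "self_adjoint_in M T \<longleftrightarrow>
    linear_operator T \<and> T \<subseteq> M \<times> M \<and> M \<subseteq> closure (Domain T) \<and> adjoint_op T \<inter> M \<times> M = T"

abbreviation self_adjoint_op :: "'a::complex_hilbert operator \<Rightarrow> bool"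
  where "self_adjoint_op \<equiv> self_adjoint_in UNIV"

definition resolvent_set :: "'a::complex_hilbert operator \<Rightarrow> complex set"
  where "resolvent_set T = {z.
    (\<forall>h. \<exists>!f. (f, h + z *\<^sub>C f) \<in> T) \<and>
    (\<exists>C. \<forall>(f, h) \<in> T. norm f \<le> C * norm (h - z *\<^sub>C f))}"

definition dissipative :: "'a::complex_hilbert operator \<Rightarrow> bool"
  where "dissipative T \<longleftrightarrow>
    linear_operator T \<and> densely_defined T \<and> (\<forall>(f, h) \<in> T. 0 \<le> Im (cinner h f))"

definition maximal_dissipative :: "'a::complex_hilbert operator \<Rightarrow> bool"
  where "maximal_dissipative T \<longleftrightarrow>
    dissipative T \<and> (\<forall>S. dissipative S \<and> T \<subseteq> S \<longrightarrow> S = T)"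

text \<open>The deficiency subspace \<open>ker (A\<^sup>* - z I)\<close>.\<close>

definition deficiency_space :: "'a::complex_hilbert operator \<Rightarrow> complex \<Rightarrow> 'a set"
  where "deficiency_space A z = {f. (f, z *\<^sub>C f) \<in> adjoint_op A}"

definition deficiency_indices_1_1 :: "'a::complex_hilbert operator \<Rightarrow> bool"
  where "deficiency_indices_1_1 A \<longleftrightarrow>
    cdim (deficiency_space A \<i>) = 1 \<and> cdim (deficiency_space A (- \<i>)) = 1"

definition orthocomplement :: "'a::complex_hilbert set \<Rightarrow> 'a set"
  where "orthocomplement M = {x. \<forall>y \<in> M. cinner x y = 0}"

text \<open>\<open>M\<close> reduces \<open>A\<close> if \<open>A\<close> is the orthogonal sum of its parts in \<open>M\<close> and in the complement of \<open>M\<close>.\<close>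

definition reducing_subspace :: "'a::complex_hilbert operator \<Rightarrow> 'a set \<Rightarrow> bool"
  where "reducing_subspace A M \<longleftrightarrow> csubspace M \<and> closed M \<and>
    (\<forall>p \<in> A. \<exists>q \<in> A \<inter> M \<times> M. \<exists>r \<in> A \<inter> orthocomplement M \<times> orthocomplement M. p = q + r)"

definition prime_op :: "'a::complex_hilbert operator \<Rightarrow> bool"
  where "prime_op A \<longleftrightarrow>
    (\<nexists>M. M \<noteq> {0} \<and> reducing_subspace A M \<and> self_adjoint_in M (A \<inter> M \<times> M))"


section \<open>The rigged Hilbert space\<close>

text \<open>
  Throughout, \<open>A\<close> is the symmetric operator which generates the rigging.
\<close>

definition H_plus :: "'a::complex_hilbert operator \<Rightarrow> 'a set"
  where "H_plus A = Domain (adjoint_op A)"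

definition plus_inner :: "'a::complex_hilbert operator \<Rightarrow> 'a \<Rightarrow> 'a \<Rightarrow> complex"
  where "plus_inner A f g = cinner f g + cinner (app (adjoint_op A) f) (app (adjoint_op A) g)"

definition plus_norm :: "'a::complex_hilbert operator \<Rightarrow> 'a \<Rightarrow> real"
  where "plus_norm A f = sqrt (Re (plus_inner A f f))"

text \<open>
  An element \<open>\<phi>\<close> of the dual is the bounded antilinear functional \<open>f \<mapsto> (\<phi>, f)\<close> on \<^const>\<open>H_plus\<close>, so
  that the inclusion of the Hilbert space into the dual is linear.  As HOL functions are total, the
  functionals are set to \<open>0\<close> outside \<^const>\<open>H_plus\<close>; equality in the dual is then equality of
  functions.
\<close>

type_synonym 'a functional = "'a \<Rightarrow> complex"

definition H_minus :: "'a::complex_hilbert operator \<Rightarrow> 'a functional set"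
  where "H_minus A = {\<phi>.
    (\<forall>f \<in> H_plus A. \<forall>g \<in> H_plus A. \<phi> (f + g) = \<phi> f + \<phi> g) \<and>
    (\<forall>c. \<forall>f \<in> H_plus A. \<phi> (c *\<^sub>C f) = cnj c * \<phi> f) \<and>
    (\<exists>C. \<forall>f \<in> H_plus A. cmod (\<phi> f) \<le> C * plus_norm A f) \<and>
    (\<forall>f. f \<notin> H_plus A \<longrightarrow> \<phi> f = 0)}"

definition minus_norm :: "'a::complex_hilbert operator \<Rightarrow> 'a functional \<Rightarrow> real"
  where "minus_norm A \<phi> = (SUP f \<in> {f \<in> H_plus A. plus_norm A f \<le> 1}. cmod (\<phi> f))"

definition embed :: "'a::complex_hilbert operator \<Rightarrow> 'a \<Rightarrow> 'a functional"
  where "embed A h = (\<lambda>g. if g \<in> H_plus A then cinner h g else 0)"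

text \<open>
  An operator from \<^const>\<open>H_plus\<close> to \<^const>\<open>H_minus\<close> is a function of which only the values on
  \<^const>\<open>H_plus\<close> matter.
\<close>

type_synonym 'a rigged_operator = "'a \<Rightarrow> 'a functional"

definition bounded_rigged :: "'a::complex_hilbert operator \<Rightarrow> 'a rigged_operator \<Rightarrow> bool"
  where "bounded_rigged A B \<longleftrightarrow>
    (\<forall>f \<in> H_plus A. B f \<in> H_minus A) \<and>
    (\<forall>f \<in> H_plus A. \<forall>g \<in> H_plus A. B (f + g) = (\<lambda>u. B f u + B g u)) \<and>
    (\<forall>c. \<forall>f \<in> H_plus A. B (c *\<^sub>C f) = (\<lambda>u. c * B f u)) \<and>
    (\<exists>C. \<forall>f \<in> H_plus A. minus_norm A (B f) \<le> C * plus_norm A f)"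

text \<open>The adjoint is determined by \<open>(B\<^sup>* f, g) = (f, B g)\<close>, the conjugate of \<open>(B g, f)\<close>.\<close>

definition rigged_adjoint :: "'a::complex_hilbert operator \<Rightarrow> 'a rigged_operator \<Rightarrow> 'a rigged_operator"
  where "rigged_adjoint A B = (\<lambda>f g. if g \<in> H_plus A then cnj (B g f) else 0)"

definition rigged_Re :: "'a::complex_hilbert operator \<Rightarrow> 'a rigged_operator \<Rightarrow> 'a rigged_operator"
  where "rigged_Re A B = (\<lambda>f g. (B f g + rigged_adjoint A B f g) / 2)"

definition rigged_Im :: "'a::complex_hilbert operator \<Rightarrow> 'a rigged_operator \<Rightarrow> 'a rigged_operator"
  where "rigged_Im A B = (\<lambda>f g. (B f g - rigged_adjoint A B f g) / (2 * \<i>))"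

text \<open>\<open>B\<close> extends the operator \<open>T\<close> of the Hilbert space.\<close>

definition rigged_extends ::
    "'a::complex_hilbert operator \<Rightarrow> 'a rigged_operator \<Rightarrow> 'a operator \<Rightarrow> bool"
  where "rigged_extends A B T \<longleftrightarrow> (\<forall>(f, h) \<in> T. f \<in> H_plus A \<and> B f = embed A h)"

definition quasi_kernel :: "'a::complex_hilbert operator \<Rightarrow> 'a rigged_operator \<Rightarrow> 'a operator"
  where "quasi_kernel A B = {(f, h). f \<in> H_plus A \<and> B f = embed A h}"

definition class_Lambda :: "'a::complex_hilbert operator \<Rightarrow> 'a operator set"
  where "class_Lambda A = {T. linear_operator T \<and> A \<subseteq> T \<and> T \<subseteq> adjoint_op A \<and>
    resolvent_set T \<noteq> {} \<and> Domain A = Domain T \<inter> Domain (adjoint_op T)}"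

definition star_extension ::
    "'a::complex_hilbert operator \<Rightarrow> 'a operator \<Rightarrow> 'a rigged_operator \<Rightarrow> bool"
  where "star_extension A T B \<longleftrightarrow> bounded_rigged A B \<and>
    rigged_extends A B T \<and> A \<subseteq> T \<and>
    rigged_extends A (rigged_adjoint A B) (adjoint_op T) \<and> A \<subseteq> adjoint_op T \<and>
    self_adjoint_op (quasi_kernel A (rigged_Re A B))"


section \<open>L-systems\<close>

definition bounded_channel ::
    "'a::complex_hilbert operator \<Rightarrow> (complex \<Rightarrow> 'a functional) \<Rightarrow> bool"
  where "bounded_channel A K \<longleftrightarrow>
    (\<forall>c. K c \<in> H_minus A) \<and>
    (\<forall>c d. K (c + d) = (\<lambda>u. K c u + K d u)) \<and>
    (\<forall>c d. K (c * d) = (\<lambda>u. c * K d u)) \<and>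
    (\<exists>C. \<forall>c. minus_norm A (K c) \<le> C * cmod c)"

text \<open>The adjoint of \<open>K\<close>: \<open>(K c, f)\<close> equals the inner product of \<open>c\<close> and \<open>K\<^sup>* f\<close>.\<close>

definition channel_adjoint :: "(complex \<Rightarrow> 'a functional) \<Rightarrow> 'a \<Rightarrow> complex"
  where "channel_adjoint K f = (THE w. \<forall>c. K c f = cinner c w)"

record 'a l_system =
  sym_op :: "'a operator"
  main_op :: "'a operator"
  state_op :: "'a rigged_operator"
  channel :: "complex \<Rightarrow> 'a functional"

definition l_system :: "'a::complex_hilbert l_system \<Rightarrow> bool"
  where "l_system \<Theta> \<longleftrightarrow>
    (let A = sym_op \<Theta>; T = main_op \<Theta>; B = state_op \<Theta>; K = channel \<Theta> in
      symmetric_op A \<and> closed A \<and> deficiency_indices_1_1 A \<and>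
      T \<in> class_Lambda A \<and>
      star_extension A T B \<and>
      bounded_channel A K \<and>
      (\<forall>f \<in> H_plus A. rigged_Im A B f = K (channel_adjoint K f)) \<and>
      range K = rigged_Im A B ` H_plus A)"

definition minimal_l_system :: "'a::complex_hilbert l_system \<Rightarrow> bool"
  where "minimal_l_system \<Theta> \<longleftrightarrow> l_system \<Theta> \<and> prime_op (sym_op \<Theta>)"

text \<open>The quasi-kernel of \<open>Re\<close> of the state-space operator.\<close>

definition hat_op :: "'a::complex_hilbert l_system \<Rightarrow> 'a operator"
  where "hat_op \<Theta> = quasi_kernel (sym_op \<Theta>) (rigged_Re (sym_op \<Theta>) (state_op \<Theta>))"

text \<open>\<open>(B - z I)\<^sup>-\<^sup>1 \<phi>\<close>, the inverse being taken of an operator from \<^const>\<open>H_plus\<close> to \<^const>\<open>H_minus\<close>.\<close>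

definition rigged_resolvent ::
    "'a::complex_hilbert operator \<Rightarrow> 'a rigged_operator \<Rightarrow> complex \<Rightarrow> 'a functional \<Rightarrow> 'a"
  where "rigged_resolvent A B z \<phi> =
    (THE f. f \<in> H_plus A \<and> (\<lambda>g. B f g - z * embed A f g) = \<phi>)"

text \<open>Operators on the one-dimensional space of complex numbers are identified with their value at 1.\<close>

definition transfer_function :: "'a::complex_hilbert l_system \<Rightarrow> complex \<Rightarrow> complex"
  where "transfer_function \<Theta> z = 1 - 2 * \<i> *
    channel_adjoint (channel \<Theta>)
      (rigged_resolvent (sym_op \<Theta>) (state_op \<Theta>) z (channel \<Theta> 1))"

definition impedance_function :: "'a::complex_hilbert l_system \<Rightarrow> complex \<Rightarrow> complex"
  where "impedance_function \<Theta> z =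
    channel_adjoint (channel \<Theta>)
      (rigged_resolvent (sym_op \<Theta>) (rigged_Re (sym_op \<Theta>) (state_op \<Theta>)) z (channel \<Theta> 1))"


section \<open>The hypotheses\<close>

text \<open>
  \<open>Adot\<close> is the symmetric operator, \<open>T\<close> its maximal dissipative extension, \<open>A\<close> its self-adjoint
  extension, and \<open>gp\<close>, \<open>gm\<close> are the deficiency elements \<open>g\<^sub>+\<close>, \<open>g\<^sub>-\<close>.  The deficiency elements are
  arguments because both hypotheses, when imposed together, refer to one and the same choice: for
  \<open>\<kappa> = 0\<close> the condition on \<open>T\<close> does not involve \<open>g\<^sub>-\<close>, and replacing \<open>g\<^sub>-\<close> by \<open>- g\<^sub>-\<close> would turn one
  hypothesis into the other.
\<close>

definition hypothesis_base ::
    "'a::complex_hilbert operator \<Rightarrow> 'a operator \<Rightarrow> 'a operator \<Rightarrow> 'a \<Rightarrow> 'a \<Rightarrow> bool"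
  where "hypothesis_base Adot T A gp gm \<longleftrightarrow>
    maximal_dissipative T \<and> Adot \<subseteq> T \<and> T \<noteq> adjoint_op T \<and>
    self_adjoint_op A \<and> Adot \<subseteq> A \<and>
    gp \<in> deficiency_space Adot \<i> \<and> gm \<in> deficiency_space Adot (- \<i>) \<and>
    norm gp = 1 \<and> norm gm = 1 \<and>
    (\<exists>\<kappa>::real. 0 \<le> \<kappa> \<and> \<kappa> < 1 \<and> gp - complex_of_real \<kappa> *\<^sub>C gm \<in> Domain T)"

definition hypothesis_I ::
    "'a::complex_hilbert operator \<Rightarrow> 'a operator \<Rightarrow> 'a operator \<Rightarrow> 'a \<Rightarrow> 'a \<Rightarrow> bool"
  where "hypothesis_I Adot T A gp gm \<longleftrightarrow>
    hypothesis_base Adot T A gp gm \<and> gp - gm \<in> Domain A"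

definition hypothesis_II ::
    "'a::complex_hilbert operator \<Rightarrow> 'a operator \<Rightarrow> 'a operator \<Rightarrow> 'a \<Rightarrow> 'a \<Rightarrow> bool"
  where "hypothesis_II Adot T A gp gm \<longleftrightarrow>
    hypothesis_base Adot T A gp gm \<and> gp + gm \<in> Domain A"

end

theory Submission
  imports Defs
begin

text \<open>
  Put \<open>u = g\<^sub>+ - \<kappa> g\<^sub>-\<close> and \<open>v = \<kappa> g\<^sub>+ - g\<^sub>-\<close>, which span the domains of \<open>T\<close> and \<open>T\<^sup>*\<close> modulo the
  domain of \<open>A\<close>.  For the channel vector \<open>\<phi> = K 1\<close>, which vanishes on the domain of \<open>A\<close>, the
  inclusions \<open>B \<supseteq> T\<close> and \<open>B\<^sup>* \<supseteq> T\<^sup>*\<close> give \<open>B f = A\<^sup>* f + 2 i b \<phi>(v)\<^sup>* \<phi>\<close> when \<open>f = q + a u + b v\<close>,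
  and the quasi-kernel condition for \<open>g\<^sub>+ - \<epsilon> g\<^sub>-\<close> becomes \<open>\<phi>(u) = \<epsilon> \<phi>(v)\<close>, where \<open>\<epsilon> = 1\<close> under
  Hypothesis I and \<open>\<epsilon> = - 1\<close> under Hypothesis II.  Hence both resolvents map \<open>\<phi>\<close> to a multiple of
  the deficiency element \<open>g = q + c u + v\<close> at \<open>z\<close>, where \<open>c\<close> depends only on \<open>T\<close> and \<open>z\<close>, and
  \<open>W = - \<epsilon> c\<close>, \<open>V = (1 + \<epsilon> c) / (i (1 - \<epsilon> c))\<close>.
\<close>

section \<open>The complex inner product and orthogonal projection in Hilbert space\<close>

lemma cinner_add_right: "cinner x (y + z) = cinner x y + cinner x (z::'a::complex_hilbert)"
  by (metis cinner_add_left cinner_commute complex_cnj_add)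

lemma cinner_scaleC_right: "cinner x (c *\<^sub>C y) = cnj c * cinner x (y::'a::complex_hilbert)"
  by (metis cinner_commute cinner_scaleC_left complex_cnj_mult)

lemma cinner_zero_left [simp]: "cinner 0 (x::'a::complex_hilbert) = 0"
  using cinner_add_left[of 0 0 x] by simp

lemma cinner_zero_right [simp]: "cinner (x::'a::complex_hilbert) 0 = 0"
  using cinner_add_right[of x 0 0] by simp

lemma cinner_minus_left: "cinner (- x) (y::'a::complex_hilbert) = - cinner x y"
  using cinner_add_left[of x "- x" y] by (simp add: eq_neg_iff_add_eq_0 add.commute)

lemma cinner_minus_right: "cinner (x::'a::complex_hilbert) (- y) = - cinner x y"
  using cinner_add_right[of x y "- y"] by (simp add: eq_neg_iff_add_eq_0 add.commute)

lemma cinner_diff_left: "cinner (x - y) (z::'a::complex_hilbert) = cinner x z - cinner y z"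
  using cinner_add_left[of x "- y" z] by (simp add: cinner_minus_left)

lemma cinner_diff_right: "cinner (x::'a::complex_hilbert) (y - z) = cinner x y - cinner x z"
  using cinner_add_right[of x y "- z"] by (simp add: cinner_minus_right)

lemmas cinner_simps = cinner_add_left cinner_add_right cinner_scaleC_left cinner_scaleC_right
  cinner_minus_left cinner_minus_right cinner_diff_left cinner_diff_right

lemma cinner_self: "cinner (x::'a::complex_hilbert) x = complex_of_real ((norm x)\<^sup>2)"
proof (rule complex_eqI)
  show "Im (cinner x x) = Im (complex_of_real ((norm x)\<^sup>2))"
    using arg_cong[OF cinner_commute[of x x], of Im] by simp
qed (simp add: power2_norm_eq_inner inner_eq_Re_cinner)

lemma cinner_self_eq_0_iff: "cinner (x::'a::complex_hilbert) x = 0 \<longleftrightarrow> x = 0"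
  by (simp add: cinner_self)

text \<open>Real and imaginary parts are both real inner products: the imaginary part comes from
  replacing \<open>x\<close> by \<open>- \<i> *\<^sub>C x\<close>. Continuity is thus inherited from
  \<open>inner\<close>.\<close>

lemma continuous_on_cinner_right: "continuous_on S (\<lambda>y. cinner (x::'a::complex_hilbert) y)"
proof -
  have "cinner x y = Complex (inner x y) (inner (- \<i> *\<^sub>C x) y)" for y
    by (simp add: complex_eq_iff inner_eq_Re_cinner cinner_simps cvs.scale_minus_left)
  then have "(\<lambda>y. cinner x y) = (\<lambda>y. Complex (inner x y) (inner (- \<i> *\<^sub>C x) y))"
    by (rule ext)
  then show ?thesis
    by (simp add: Complex_eq) (intro continuous_intros)
qed

lemma cinner_eq_0_dense:
  fixes x :: "'a::complex_hilbert"
  assumes "closure D = UNIV" and "\<And>y. y \<in> D \<Longrightarrow> cinner x y = 0"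
  shows "x = 0"
proof -
  have "cinner x y = 0" for y
    using continuous_constant_on_closure[of D "\<lambda>y. cinner x y" 0 y]
      continuous_on_cinner_right assms by blast
  then show ?thesis
    using cinner_self_eq_0_iff by blast
qed

text \<open>A minimizing sequence for the distance from \<open>p\<close> to \<open>M\<close> is
  Cauchy, and its limit is the foot of the perpendicular. It is needed for the graph of
  \<open>A\<close>, a closed subspace of the product space.\<close>

lemma csubspace_projection_exists:
  fixes M :: "'a::complex_hilbert set"
  assumes sub: "csubspace M" and "closed M"
  obtains a where "a \<in> M" "\<And>y. y \<in> M \<Longrightarrow> cinner (p - a) y = 0"
proof -
  note M = sub
  define S where "S = (\<lambda>m. (norm (p - m))\<^sup>2) ` M"
  define d where "d = Inf S"
  have "0 \<in> M"
    using M by (rule cvs.subspace_0)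
  then have ne: "S \<noteq> {}"
    unfolding S_def by blast
  have "bdd_below S"
    unfolding S_def by (rule bdd_belowI[of _ 0]) auto
  then have lower: "d \<le> (norm (p - m))\<^sup>2" if "m \<in> M" for m
    unfolding d_def using that by (intro cInf_lower) (auto simp: S_def)
  have "\<exists>m \<in> M. (norm (p - m))\<^sup>2 < d + 1 / real (Suc n)" for n
  proof -
    have "Inf S < d + 1 / real (Suc n)"
      by (simp add: d_def)
    then obtain s where "s \<in> S" "s < d + 1 / real (Suc n)"
      using cInf_lessD[OF ne] by blast
    then show ?thesis
      by (auto simp: S_def)
  qed
  then obtain X where X: "\<And>n. X n \<in> M" "\<And>n. (norm (p - X n))\<^sup>2 < d + 1 / real (Suc n)"
    by metis
  \<comment> \<open>Parallelogram law for \<open>p - x\<close> and \<open>p - y\<close>; the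
    midpoint of \<open>x\<close> and \<open>y\<close> stays in \<open>M\<close>, so its squared
    distance from \<open>p\<close> is at least \<open>d\<close>.\<close>
  have midpoint: "(norm (x - y))\<^sup>2 \<le> 2 * (norm (p - x))\<^sup>2 + 2 * (norm (p - y))\<^sup>2 - 4 * d"
    if "x \<in> M" "y \<in> M" for x y
  proof -
    have "(1/2) *\<^sub>R (x + y) \<in> M"
      unfolding scaleR_scaleC using that M by (intro cvs.subspace_scale cvs.subspace_add)
    then have "d \<le> (norm (p - (1/2) *\<^sub>R (x + y)))\<^sup>2"
      by (rule lower)
    moreover have "(norm (x - y))\<^sup>2 + 4 * (norm (p - (1/2) *\<^sub>R (x + y)))\<^sup>2
        = 2 * (norm (p - x))\<^sup>2 + 2 * (norm (p - y))\<^sup>2"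
      by (simp add: power2_norm_eq_inner inner_simps inner_commute algebra_simps)
    ultimately show ?thesis
      by linarith
  qed
  have "Cauchy X"
  proof (rule CauchyI)
    fix e :: real
    assume "e > 0"
    then obtain N where N: "1 / real (Suc N) < e\<^sup>2 / 4"
      using nat_approx_posE[of "e\<^sup>2 / 4"] by auto
    have small: "(norm (p - X n))\<^sup>2 < d + e\<^sup>2 / 4" if "n \<ge> N" for n
    proof -
      have "1 / real (Suc n) \<le> 1 / real (Suc N)"
        using that by (simp add: frac_le)
      then show ?thesis
        using X(2)[of n] N by linarith
    qed
    show "\<exists>N. \<forall>m\<ge>N. \<forall>n\<ge>N. norm (X m - X n) < e"
    proof (intro exI allI impI)
      fix m n assume "m \<ge> N" "n \<ge> N"
      then have "(norm (X m - X n))\<^sup>2 < e\<^sup>2"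
        using midpoint[OF X(1) X(1), of m n] small[of m] small[of n] by linarith
      then show "norm (X m - X n) < e"
        using \<open>e > 0\<close> by (simp add: power_less_imp_less_base)
    qed
  qed
  then obtain a where a: "X \<longlonglongrightarrow> a"
    using Cauchy_convergent convergent_def by blast
  have "a \<in> M"
    using closed_sequentially[OF \<open>closed M\<close>] X(1) a by blast
  have "(\<lambda>n. (norm (p - X n))\<^sup>2) \<longlonglongrightarrow> (norm (p - a))\<^sup>2"
    using a by (intro tendsto_intros)
  moreover have "(\<lambda>n. d + 1 / real (Suc n)) \<longlonglongrightarrow> d + 0"
    using LIMSEQ_inverse_real_of_nat by (intro tendsto_intros) (simp add: inverse_eq_divide)
  ultimately have le: "(norm (p - a))\<^sup>2 \<le> d"
    using X(2) by (intro LIMSEQ_le[of "\<lambda>n. (norm (p - X n))\<^sup>2"]) (auto intro: less_imp_le)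
  have orth: "inner (p - a) y = 0" if "y \<in> M" for y
  proof (cases "y = 0")
    case False
    define s where "s = inner (p - a) y"
    \<comment> \<open>The quadratic in \<open>t\<close> giving the squared distance from
      \<open>p\<close> to \<open>a + t *\<^sub>R y\<close> has its minimum here.\<close>
    define t where "t = s / (norm y)\<^sup>2"
    have "a + t *\<^sub>R y \<in> M"
      unfolding scaleR_scaleC using that \<open>a \<in> M\<close> M
      by (intro cvs.subspace_scale cvs.subspace_add)
    then have "(norm (p - a))\<^sup>2 \<le> (norm (p - (a + t *\<^sub>R y)))\<^sup>2"
      using le lower order_trans by blast
    also have "\<dots> = (norm (p - a))\<^sup>2 - 2 * t * s + t\<^sup>2 * (norm y)\<^sup>2"
      unfolding power2_norm_eq_inner
      by (simp add: s_def inner_simps inner_commute power2_eq_square algebra_simps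
          del: inner_same_Basis)
    also have "\<dots> = (norm (p - a))\<^sup>2 - s\<^sup>2 / (norm y)\<^sup>2"
      using False by (simp add: t_def field_simps power2_eq_square)
    finally have "s\<^sup>2 / (norm y)\<^sup>2 \<le> 0"
      by simp
    then show ?thesis
      using False by (simp add: s_def divide_le_0_iff)
  qed simp
  have "cinner (p - a) y = 0" if "y \<in> M" for y
  proof (rule complex_eqI)
    show "Re (cinner (p - a) y) = Re 0"
      using orth[OF that] by (simp add: inner_eq_Re_cinner)
    \<comment> \<open>Real orthogonality to \<open>\<i> *\<^sub>C y\<close> is the vanishing of the
      imaginary part.\<close>
    have "\<i> *\<^sub>C y \<in> M"
      using that M by (intro cvs.subspace_scale)
    from orth[OF this] show "Im (cinner (p - a) y) = Im 0"
      by (simp add: inner_eq_Re_cinner cinner_scaleC_right)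
  qed
  with \<open>a \<in> M\<close> show thesis
    by (rule that)
qed

section \<open>Adjoints as graphs and the von Neumann decomposition\<close>

lemma adjoint_opD: "(f, h) \<in> adjoint_op T \<Longrightarrow> (u, v) \<in> T \<Longrightarrow> cinner v f = cinner u h"
  by (auto simp: adjoint_op_def)

lemma adjoint_op_antimono: "S \<subseteq> T \<Longrightarrow> adjoint_op T \<subseteq> adjoint_op S"
  by (fastforce simp: adjoint_op_def)

lemma csubspace_adjoint_op: "cvs.subspace (adjoint_op T)"
  by (rule cvs.subspaceI)
    (fastforce simp: adjoint_op_def cinner_simps scaleC_prod_def zero_prod_def)+

lemma csubspace_Domain:
  fixes T :: "'a::complex_hilbert operator"
  assumes "cvs.subspace T"
  shows "cvs.subspace (Domain T)"
proof (rule cvs.subspaceI)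
  show "0 \<in> Domain T"
    using cvs.subspace_0[OF assms] by (auto simp: zero_prod_def)
  show "x + y \<in> Domain T" if "x \<in> Domain T" "y \<in> Domain T" for x y
    using that cvs.subspace_add[OF assms] by fastforce
  show "c *\<^sub>C x \<in> Domain T" if "x \<in> Domain T" for c x
    using that cvs.subspace_scale[OF assms] by (fastforce simp: scaleC_prod_def)
qed

lemma single_valued_adjoint_op:
  assumes "densely_defined T"
  shows "single_valued (adjoint_op T)"
proof (rule single_valuedI)
  fix f h h'
  assume h: "(f, h) \<in> adjoint_op T" "(f, h') \<in> adjoint_op T"
  have "h - h' = 0"
  proof (rule cinner_eq_0_dense)
    show "closure (Domain T) = UNIV"
      using assms by (simp add: densely_defined_def)
    fix y assume "y \<in> Domain T"
    then obtain v where "(y, v) \<in> T"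
      by blast
    with h have "cinner y h = cinner y h'"
      by (metis adjoint_opD)
    then have "cinner y (h - h') = 0"
      by (simp add: cinner_simps)
    then show "cinner (h - h') y = 0"
      by (metis cinner_commute complex_cnj_zero)
  qed
  then show "h = h'" by simp
qed

lemma cdim_1_imp_multiple:
  assumes "cdim V = 1" and "g \<in> V" "g \<noteq> 0" "x \<in> V"
  obtains c where "x = c *\<^sub>C g"
proof -
  obtain B where B: "V \<subseteq> cvs.span B" "card B = cvs.dim V"
    using cvs.basis_exists by blast
  then obtain b where "B = {b}"
    using assms(1) card_1_singletonE by metis
  with B assms obtain r s where r: "g = r *\<^sub>C b" and s: "x = s *\<^sub>C b"
    by (force simp: cvs.span_singleton)
  then have "x = (s / r) *\<^sub>C g"
    using \<open>g \<noteq> 0\<close> by (auto simp: scaleC_scaleC)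
  then show thesis ..
qed

text \<open>
  The complement of the graph of \<open>A\<close> in the graph of \<open>A\<^sup>*\<close> consists of the pairs \<open>(x, y)\<close> with
  \<open>A\<^sup>* x = y\<close> and \<open>A\<^sup>* y = - x\<close>; then \<open>y \<plusminus> i x\<close> lie in the deficiency spaces.
\<close>

lemma von_Neumann_decomposition:
  fixes A :: "'a::complex_hilbert operator"
  assumes "symmetric_op A" "closed A" "deficiency_indices_1_1 A"
    and gp: "gp \<in> deficiency_space A \<i>" "gp \<noteq> 0"
    and gm: "gm \<in> deficiency_space A (- \<i>)" "gm \<noteq> 0"
    and p: "p \<in> adjoint_op A"
  obtains q a b where "q \<in> A" "p = q + a *\<^sub>C (gp, \<i> *\<^sub>C gp) + b *\<^sub>C (gm, - \<i> *\<^sub>C gm)"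
proof -
  have "csubspace A"
    using assms(1) by (simp add: symmetric_op_def linear_operator_def)
  then obtain q where q: "q \<in> A" "\<And>s. s \<in> A \<Longrightarrow> cinner (p - q) s = 0"
    using csubspace_projection_exists \<open>closed A\<close> by metis
  obtain x y where xy: "p - q = (x, y)"
    by (cases "p - q")
  note sub = csubspace_adjoint_op[of A]
  have "q \<in> adjoint_op A"
    using q(1) assms(1) by (auto simp: symmetric_op_def)
  with p have 1: "(x, y) \<in> adjoint_op A"
    using cvs.subspace_diff[OF sub] xy by metis
  have "cinner v y = cinner u (- x)" if "(u, v) \<in> A" for u v
  proof -
    have "cinner x u + cinner y v = 0"
      using q(2)[OF that] xy by (simp add: cinner_prod_def)
    then have "cinner u x + cinner v y = 0"
      by (metis cinner_commute complex_cnj_add complex_cnj_zero)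
    then show ?thesis
      by (simp add: cinner_simps eq_neg_iff_add_eq_0 add.commute)
  qed
  then have 2: "(y, - x) \<in> adjoint_op A"
    by (auto simp: adjoint_op_def)
  have "y + \<i> *\<^sub>C x \<in> deficiency_space A \<i>"
    using cvs.subspace_add[OF sub 2 cvs.subspace_scale[OF sub 1, of \<i>]]
    by (simp add: deficiency_space_def scaleC_prod_def scaleC_add_right scaleC_scaleC add.commute)
  then obtain \<alpha> where \<alpha>: "y + \<i> *\<^sub>C x = \<alpha> *\<^sub>C gp"
    using cdim_1_imp_multiple gp assms(3) by (metis deficiency_indices_1_1_def)
  have "y - \<i> *\<^sub>C x \<in> deficiency_space A (- \<i>)"
    using cvs.subspace_diff[OF sub 2 cvs.subspace_scale[OF sub 1, of \<i>]]
    by (simp add: deficiency_space_def scaleC_prod_def cvs.scale_right_diff_distrib scaleC_scaleC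
        minus_diff_commute)
  then obtain \<beta> where \<beta>: "y - \<i> *\<^sub>C x = \<beta> *\<^sub>C gm"
    using cdim_1_imp_multiple gm assms(3) by (metis deficiency_indices_1_1_def)
  \<comment> \<open>\<open>x\<close> and \<open>y\<close> are recovered from the half difference and
    half sum of \<open>y + \<i> *\<^sub>C x\<close> and \<open>y - \<i> *\<^sub>C x\<close>.\<close>
  have "x = (- \<i> / 2) *\<^sub>C (2 * \<i>) *\<^sub>C x"
    by (simp add: scaleC_scaleC)
  also have "(2 * \<i>) *\<^sub>C x = (y + \<i> *\<^sub>C x) - (y - \<i> *\<^sub>C x)"
    by (simp flip: scaleC_add_left)
  finally have x: "x = (- \<i> / 2 * \<alpha>) *\<^sub>C gp + (\<i> / 2 * \<beta>) *\<^sub>C gm"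
    unfolding \<alpha> \<beta> by (simp add: cvs.scale_right_diff_distrib scaleC_scaleC cvs.scale_minus_left)
  have "y = (1 / 2) *\<^sub>C 2 *\<^sub>C y"
    by (simp add: scaleC_scaleC)
  also have "2 *\<^sub>C y = (y + \<i> *\<^sub>C x) + (y - \<i> *\<^sub>C x)"
    by (simp flip: scaleC_add_left[of 1 1 y, simplified])
  finally have y: "y = (1 / 2 * \<alpha>) *\<^sub>C gp + (1 / 2 * \<beta>) *\<^sub>C gm"
    unfolding \<alpha> \<beta> by (simp add: scaleC_add_right scaleC_scaleC)
  have "\<i> * c * \<i> = - c" for c
    by (simp add: mult.commute mult.left_commute)
  moreover have "p = q + (x, y)"
    using xy by (simp add: algebra_simps)
  ultimately have "p = q + (- \<i> / 2 * \<alpha>) *\<^sub>C (gp, \<i> *\<^sub>C gp) + (\<i> / 2 * \<beta>) *\<^sub>C (gm, - \<i> *\<^sub>C gm)"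
    by (simp add: x y scaleC_prod_def scaleC_scaleC prod_eq_iff)
  with q(1) show thesis
    by (rule that)
qed


section \<open>The geometry of the main operator\<close>

text \<open>It holds only data shared by the two L-systems, so everything obtained from it, in
  particular the coefficient \<open>c\<close> of \<open>deficiency_element\<close>, is common to
  both.\<close>

locale dissipative_extension =
  fixes A T :: "'a::complex_hilbert operator" and gp gm :: 'a and \<kappa> :: real
  assumes symmetric: "symmetric_op A"
    and closed: "closed A"
    and indices: "deficiency_indices_1_1 A"
    and Lambda: "T \<in> class_Lambda A"
    and dissipative: "dissipative T"
    and gp: "gp \<in> deficiency_space A \<i>" "norm gp = 1"
    and gm: "gm \<in> deficiency_space A (- \<i>)" "norm gm = 1"
    and kappa: "0 \<le> \<kappa>" "\<kappa> < 1"
    and gp_gm_T: "gp - complex_of_real \<kappa> *\<^sub>C gm \<in> Domain T"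
begin

text \<open>The primed vectors are the images of \<open>u\<close> and \<open>v\<close> under
  \<open>adjoint_op A\<close>, which multiplies \<open>gp\<close> by \<i> and \<open>gm\<close> by -
  \<i>.\<close>

definition u :: 'a where "u = gp - complex_of_real \<kappa> *\<^sub>C gm"
definition u' :: 'a where "u' = \<i> *\<^sub>C gp + (\<i> * \<kappa>) *\<^sub>C gm"
definition v :: 'a where "v = complex_of_real \<kappa> *\<^sub>C gp - gm"
definition v' :: 'a where "v' = (\<i> * \<kappa>) *\<^sub>C gp + \<i> *\<^sub>C gm"

lemma densely_defined: "densely_defined A"
  using symmetric by (simp add: symmetric_op_def)

lemma subspace_A: "csubspace A"
  using symmetric by (simp add: symmetric_op_def linear_operator_def)

lemma A_subset_adjoint: "A \<subseteq> adjoint_op A"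
  using symmetric by (simp add: symmetric_op_def)

lemma subspace_T: "csubspace T"
  using Lambda by (simp add: class_Lambda_def linear_operator_def)

lemma A_subset_T: "A \<subseteq> T" and T_subset_adjoint: "T \<subseteq> adjoint_op A"
  using Lambda by (simp_all add: class_Lambda_def)

lemma gp_pair: "(gp, \<i> *\<^sub>C gp) \<in> adjoint_op A" and gm_pair: "(gm, - \<i> *\<^sub>C gm) \<in> adjoint_op A"
  using gp gm by (simp_all add: deficiency_space_def)

lemma adjoint_unique: "(f, h) \<in> adjoint_op A \<Longrightarrow> (f, h') \<in> adjoint_op A \<Longrightarrow> h = h'"
  using single_valued_adjoint_op[OF densely_defined] by (auto dest: single_valuedD)

lemma u_pair_adjoint: "(u, u') \<in> adjoint_op A"
proof -
  have "(gp, \<i> *\<^sub>C gp) - complex_of_real \<kappa> *\<^sub>C (gm, - \<i> *\<^sub>C gm) = (u, u')"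
    by (simp add: u_def u'_def scaleC_prod_def scaleC_scaleC mult.commute)
  then show ?thesis
    using cvs.subspace_diff[OF csubspace_adjoint_op gp_pair
        cvs.subspace_scale[OF csubspace_adjoint_op gm_pair, of \<kappa>]] by metis
qed

lemma v_pair_adjoint: "(v, v') \<in> adjoint_op A"
proof -
  have "complex_of_real \<kappa> *\<^sub>C (gp, \<i> *\<^sub>C gp) - (gm, - \<i> *\<^sub>C gm) = (v, v')"
    by (simp add: v_def v'_def scaleC_prod_def scaleC_scaleC mult.commute)
  then show ?thesis
    using cvs.subspace_diff[OF csubspace_adjoint_op
        cvs.subspace_scale[OF csubspace_adjoint_op gp_pair, of \<kappa>] gm_pair] by metis
qed

lemma u_pair_T: "(u, u') \<in> T"
proof -
  obtain h where h: "(u, h) \<in> T"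
    using gp_gm_T by (auto simp: u_def)
  with T_subset_adjoint u_pair_adjoint have "h = u'"
    by (blast intro: adjoint_unique)
  with h show ?thesis
    by simp
qed

text \<open>Up to sign this is the determinant of the passage from \<open>gp\<close>,
  \<open>gm\<close> to \<open>u\<close>, \<open>v\<close>.\<close>

lemma kappa_square: "1 - (complex_of_real \<kappa>)\<^sup>2 \<noteq> 0"
proof -
  have "\<kappa>\<^sup>2 < 1"
    using kappa by (simp add: power_less_one_iff)
  then have "complex_of_real (1 - \<kappa>\<^sup>2) \<noteq> 0"
    by (simp del: of_real_diff of_real_power)
  then show ?thesis
    by simp
qed

lemma adjoint_decomposition:
  assumes "p \<in> adjoint_op A"
  obtains q a b where "q \<in> A" "p = q + a *\<^sub>C (u, u') + b *\<^sub>C (v, v')"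
proof -
  obtain q a b where q: "q \<in> A" "p = q + a *\<^sub>C (gp, \<i> *\<^sub>C gp) + b *\<^sub>C (gm, - \<i> *\<^sub>C gm)"
    using gp(2) gm(2)
    by (auto intro: von_Neumann_decomposition[OF symmetric closed indices gp(1) _ gm(1) _ assms])
  \<comment> \<open>The inverse change of basis: \<open>u\<close> - \<kappa> \<open>v\<close> and
    \<kappa> \<open>u\<close> - \<open>v\<close> are 1 - \<kappa>^2 times \<open>gp\<close> and
    \<open>gm\<close>, respectively.\<close>
  define s where "s = 1 / (1 - (complex_of_real \<kappa>)\<^sup>2)"
  have s: "s - s * (complex_of_real \<kappa>)\<^sup>2 = 1"
    using kappa_square by (simp add: s_def field_simps)
  have gp_eq: "(gp, \<i> *\<^sub>C gp) = s *\<^sub>C (u, u') - (s * \<kappa>) *\<^sub>C (v, v')"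
  proof -
    have "s *\<^sub>C u - (s * \<kappa>) *\<^sub>C v = (s - s * \<kappa>\<^sup>2) *\<^sub>C gp"
      by (simp add: u_def v_def cvs.scale_right_diff_distrib cvs.scale_left_diff_distrib
          scaleC_scaleC power2_eq_square mult.assoc)
    moreover have "s *\<^sub>C u' - (s * \<kappa>) *\<^sub>C v' = (\<i> * (s - s * \<kappa>\<^sup>2)) *\<^sub>C gp"
      by (simp add: u'_def v'_def scaleC_add_right cvs.scale_left_diff_distrib
          scaleC_scaleC power2_eq_square algebra_simps)
    ultimately show ?thesis
      by (simp add: s scaleC_prod_def)
  qed
  have gm_eq: "(gm, - \<i> *\<^sub>C gm) = (s * \<kappa>) *\<^sub>C (u, u') - s *\<^sub>C (v, v')"
  proof -
    have "(s * \<kappa>) *\<^sub>C u - s *\<^sub>C v = (s - s * \<kappa>\<^sup>2) *\<^sub>C gm"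
      by (simp add: u_def v_def cvs.scale_right_diff_distrib cvs.scale_left_diff_distrib
          scaleC_scaleC power2_eq_square mult.assoc)
    moreover have "(s * \<kappa>) *\<^sub>C u' - s *\<^sub>C v' = (- \<i> * (s - s * \<kappa>\<^sup>2)) *\<^sub>C gm"
      by (simp add: u'_def v'_def scaleC_add_right cvs.scale_left_diff_distrib
          scaleC_scaleC power2_eq_square algebra_simps)
    ultimately show ?thesis
      by (simp add: s scaleC_prod_def)
  qed
  have "p = q + (a * s + b * s * \<kappa>) *\<^sub>C (u, u') + (- (a * s * \<kappa>) - b * s) *\<^sub>C (v, v')"
    unfolding q(2) gp_eq gm_eq
    by (simp only: cvs.scale_right_diff_distrib cvs.scale_left_diff_distrib scaleC_scaleC
        scaleC_add_left cvs.scale_minus_left mult.assoc) (simp add: algebra_simps)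
  with q(1) show thesis
    by (rule that)
qed

text \<open>With w the inner product of \<open>gp\<close> and \<open>gm\<close>, the cross terms add
  up to \<i> \<kappa> (cnj w - w), which is real. The negative sign of the remaining part keeps
  \<open>v\<close> out of the dissipative \<open>T\<close> and later forces
  \<open>\<phi> v \<noteq> 0\<close>.\<close>

lemma Im_v'_v: "Im (cinner v' v) = \<kappa>\<^sup>2 - 1"
proof -
  have "cinner gm gp = cnj (cinner gp gm)"
    by (rule cinner_commute)
  then show ?thesis
    using gp(2) gm(2)
    by (simp add: v_def v'_def cinner_simps cinner_self power2_eq_square algebra_simps)
qed

lemma Im_v'_v_neg: "Im (cinner v' v) < 0"
  using kappa by (simp add: Im_v'_v power_less_one_iff)

lemma v_pair_notin_T: "(v, v') \<notin> T"
  using dissipative Im_v'_v_neg by (fastforce simp: dissipative_def)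

text \<open>A nonzero coefficient of \<open>(v, v')\<close> would, after subtracting the other terms
  and rescaling, put \<open>(v, v')\<close> into \<open>T\<close>.\<close>

lemma T_decomposition:
  assumes "p \<in> T"
  obtains q a where "q \<in> A" "p = q + a *\<^sub>C (u, u')"
proof -
  obtain q a b where q: "q \<in> A" "p = q + a *\<^sub>C (u, u') + b *\<^sub>C (v, v')"
    using adjoint_decomposition assms T_subset_adjoint by blast
  have "q + a *\<^sub>C (u, u') \<in> T"
    using q(1) A_subset_T u_pair_T subspace_T by (blast intro: cvs.subspace_add cvs.subspace_scale)
  with assms q(2) have bv: "b *\<^sub>C (v, v') \<in> T"
    using cvs.subspace_diff[OF subspace_T] by fastforce
  have "b = 0"
  proof (rule ccontr)
    assume "b \<noteq> 0"
    then have "(v, v') = (1 / b) *\<^sub>C b *\<^sub>C (v, v')"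
      by (simp add: scaleC_scaleC del: cvs.scale_scale)
    then show False
      using v_pair_notin_T cvs.subspace_scale[OF subspace_T bv] by metis
  qed
  with q have "p = q + a *\<^sub>C (u, u')"
    by simp
  with q(1) show thesis
    by (rule that)
qed

text \<open>On \<open>A\<close> the identity is \<open>v_pair_adjoint\<close>. On \<open>u\<close>
  the diagonal terms cancel because \<open>gp\<close> and \<open>gm\<close> have equal norms, and
  the cross terms agree on both sides.\<close>

lemma v_pair_adjoint_T: "(v, v') \<in> adjoint_op T"
proof -
  have "cinner h v = cinner f v'" if "(f, h) \<in> T" for f h
  proof -
    obtain q a where q: "q \<in> A" "(f, h) = q + a *\<^sub>C (u, u')"
      using \<open>(f, h) \<in> T\<close> by (rule T_decomposition)
    have "cinner (snd q) v = cinner (fst q) v'"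
      using adjoint_opD[OF v_pair_adjoint, of "fst q" "snd q"] q(1) by simp
    moreover have "cinner u' v = cinner u v'"
      using gp(2) gm(2) by (simp add: u_def u'_def v_def v'_def cinner_simps cinner_self algebra_simps)
    ultimately show ?thesis
      using q(2) by (simp add: prod_eq_iff scaleC_prod_def cinner_simps)
  qed
  then show ?thesis
    by (auto simp: adjoint_op_def)
qed

text \<open>Let f be the resolvent of \<open>T\<close> at \<open>z\<close> applied to
  \<open>v' - z *\<^sub>C v\<close>. Then \<open>g = v - f\<close> is in the kernel of
  \<open>adjoint_op A\<close> minus \<open>z\<close>, and since f is in the domain of
  \<open>T\<close> its coefficient at \<open>v\<close> is 1.\<close>

lemma deficiency_element:
  assumes "z \<in> resolvent_set T"
  obtains q c g where "q \<in> A" "(g, z *\<^sub>C g) = q + c *\<^sub>C (u, u') + (v, v')"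
proof -
  obtain f where "(f, (v' - z *\<^sub>C v) + z *\<^sub>C f) \<in> T"
    using assms unfolding resolvent_set_def by blast
  then obtain q a where q: "q \<in> A" "(f, (v' - z *\<^sub>C v) + z *\<^sub>C f) = q + a *\<^sub>C (u, u')"
    by (rule T_decomposition)
  have "(v - f, z *\<^sub>C (v - f)) = (v, v') - (f, (v' - z *\<^sub>C v) + z *\<^sub>C f)"
    by (simp add: cvs.scale_right_diff_distrib)
  also have "\<dots> = - q + (- a) *\<^sub>C (u, u') + (v, v')"
    unfolding q(2) by (simp add: cvs.scale_minus_left)
  finally show thesis
    using that cvs.subspace_neg[OF subspace_A q(1)] by blast
qed

end


section \<open>Absence of eigenvectors\<close>

lemma resolvent_set_injective:
  assumes "linear_operator T" and "z \<in> resolvent_set T" and "(f, z *\<^sub>C f) \<in> T"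
  shows "f = 0"
proof -
  have "(0, 0 + z *\<^sub>C 0) \<in> T"
    using assms(1) cvs.subspace_0 by (fastforce simp: linear_operator_def zero_prod_def)
  moreover have "(f, 0 + z *\<^sub>C f) \<in> T"
    using assms(3) by simp
  ultimately show ?thesis
    using assms(2) unfolding resolvent_set_def by blast
qed

lemma self_adjoint_injective:
  assumes "self_adjoint_op S" and "(f, z *\<^sub>C f) \<in> S" and "Im z \<noteq> 0"
  shows "f = 0"
proof -
  have "(f, z *\<^sub>C f) \<in> adjoint_op S"
    using assms(1,2) by (auto simp: self_adjoint_in_def)
  then have "cinner (z *\<^sub>C f) f = cinner f (z *\<^sub>C f)"
    using assms(2) by (rule adjoint_opD)
  then have "(z - cnj z) * cinner f f = 0"
    by (simp add: cinner_simps algebra_simps)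
  moreover have "z - cnj z \<noteq> 0"
    using assms(3) by (simp add: complex_eq_iff)
  ultimately show ?thesis
    by (simp add: cinner_self_eq_0_iff)
qed

section \<open>A single L-system in the coordinates given by \<open>u\<close> and
  \<open>v\<close>\<close>

locale dissipative_system = dissipative_extension A T gp gm \<kappa>
  for A T :: "'a::complex_hilbert operator" and gp gm :: 'a and \<kappa> :: real +
  fixes B :: "'a rigged_operator" and K :: "complex \<Rightarrow> 'a functional" and \<epsilon> :: complex
  assumes star_extension: "star_extension A T B"
    and channel: "bounded_channel A K"
    and Im_B: "f \<in> H_plus A \<Longrightarrow> rigged_Im A B f = K (channel_adjoint K f)"
    and eps: "\<epsilon> = 1 \<or> \<epsilon> = - 1"
    and A_subset_hat: "A \<subseteq> quasi_kernel A (rigged_Re A B)"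
    and gp_gm_hat: "gp - \<epsilon> *\<^sub>C gm \<in> Domain (quasi_kernel A (rigged_Re A B))"
begin

definition \<phi> :: "'a functional" where "\<phi> = K 1"

lemma phi_H_minus: "\<phi> \<in> H_minus A"
  using channel by (simp add: bounded_channel_def \<phi>_def)

lemma phi_add: "f \<in> H_plus A \<Longrightarrow> g \<in> H_plus A \<Longrightarrow> \<phi> (f + g) = \<phi> f + \<phi> g"
  and phi_scale: "f \<in> H_plus A \<Longrightarrow> \<phi> (c *\<^sub>C f) = cnj c * \<phi> f"
  and phi_outside: "f \<notin> H_plus A \<Longrightarrow> \<phi> f = 0"
  using phi_H_minus by (simp_all add: H_minus_def)

lemma K_eq: "K c f = c * \<phi> f"
proof -
  have "K (c * 1) = (\<lambda>f. c * K 1 f)"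
    using channel by (simp only: bounded_channel_def)
  then show ?thesis
    by (simp add: \<phi>_def)
qed

lemma channel_adjoint_eq: "channel_adjoint K f = cnj (\<phi> f)"
  unfolding channel_adjoint_def
proof (rule the_equality)
  show "\<forall>c. K c f = cinner c (cnj (\<phi> f))"
    by (simp add: K_eq cinner_complex_def)
  fix w assume "\<forall>c. K c f = cinner c w"
  from this[rule_format, of 1] show "w = cnj (\<phi> f)"
    by (simp add: K_eq cinner_complex_def)
qed

text \<open>The channel is one-dimensional, so the imaginary part has rank one; the conjugate
  appears because \<open>\<phi>\<close> is antilinear.\<close>

lemma rigged_Im_eq: "f \<in> H_plus A \<Longrightarrow> rigged_Im A B f g = cnj (\<phi> f) * \<phi> g"
  by (simp add: Im_B channel_adjoint_eq K_eq)

lemma H_plusI: "(f, h) \<in> adjoint_op A \<Longrightarrow> f \<in> H_plus A"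
  by (auto simp: H_plus_def)

lemma B_add: "f \<in> H_plus A \<Longrightarrow> g \<in> H_plus A \<Longrightarrow> B (f + g) y = B f y + B g y"
  and B_scale: "f \<in> H_plus A \<Longrightarrow> B (c *\<^sub>C f) y = c * B f y"
  and B_outside: "f \<in> H_plus A \<Longrightarrow> y \<notin> H_plus A \<Longrightarrow> B f y = 0"
  using star_extension by (simp_all add: star_extension_def bounded_rigged_def H_minus_def)

lemma B_T: "(f, h) \<in> T \<Longrightarrow> B f y = embed A h y"
  using star_extension by (fastforce simp: star_extension_def rigged_extends_def)

lemma rigged_adjoint_B: "(f, h) \<in> adjoint_op T \<Longrightarrow> rigged_adjoint A B f y = embed A h y"
  using star_extension by (fastforce simp: star_extension_def rigged_extends_def)

lemma self_adjoint_hat: "self_adjoint_op (quasi_kernel A (rigged_Re A B))"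
  using star_extension by (simp add: star_extension_def)

text \<open>Taking adjoints reverses \<open>A_subset_hat\<close>, and the quasi-kernel is its own
  adjoint.\<close>

lemma hat_subset_adjoint: "quasi_kernel A (rigged_Re A B) \<subseteq> adjoint_op A"
  using adjoint_op_antimono[OF A_subset_hat] self_adjoint_hat by (auto simp: self_adjoint_in_def)

lemma v_H_plus: "v \<in> H_plus A" and u_H_plus: "u \<in> H_plus A"
  using u_pair_adjoint v_pair_adjoint by (auto intro: H_plusI)

lemma A_H_plus: "(f, h) \<in> A \<Longrightarrow> f \<in> H_plus A"
  using A_subset_adjoint by (auto intro: H_plusI)

text \<open>\<open>B\<close> and its adjoint both act as \<open>A\<close> on the domain of
  \<open>A\<close>, so the imaginary part vanishes there; its value at \<open>f f\<close> is the
  squared modulus of \<open>\<phi> f\<close>.\<close>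

lemma phi_A:
  assumes "(f, h) \<in> A"
  shows "\<phi> f = 0"
proof -
  have "A \<subseteq> adjoint_op T"
    using star_extension by (simp add: star_extension_def)
  with assms A_subset_T have "rigged_Im A B f f = 0"
    using B_T[of f h f] rigged_adjoint_B[of f h f] by (simp add: rigged_Im_def subset_iff)
  then show ?thesis
    using rigged_Im_eq A_H_plus assms by simp
qed

text \<open>\<open>B\<close> is its adjoint plus 2 \<i> times its imaginary part, and the adjoint
  extends \<open>adjoint_op T\<close>, which sends \<open>v\<close> to \<open>v'\<close>.\<close>

lemma B_v: "B v y = embed A v' y + 2 * \<i> * cnj (\<phi> v) * \<phi> y"
  using rigged_Im_eq[OF v_H_plus, of y] rigged_adjoint_B[OF v_pair_adjoint_T, of y]
  by (simp add: rigged_Im_def field_simps)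

text \<open>Otherwise \<open>B v v\<close> and its conjugate would both equal
  \<open>cinner v' v\<close>, which is not real.\<close>

lemma phi_v_nonzero: "\<phi> v \<noteq> 0"
proof
  assume "\<phi> v = 0"
  then have "B v v = cinner v' v"
    using v_H_plus by (simp add: B_v embed_def)
  moreover have "cnj (B v v) = cinner v' v"
    using rigged_adjoint_B[OF v_pair_adjoint_T, of v] v_H_plus
    by (simp add: rigged_adjoint_def embed_def)
  ultimately have "Im (cinner v' v) = 0"
    by (metis complex_cnj_cancel_iff Reals_cnj_iff complex_is_Real_iff)
  then show False
    using Im_v'_v_neg by simp
qed

lemma subspace_H_plus: "cvs.subspace (H_plus A)"
  unfolding H_plus_def using csubspace_adjoint_op by (rule csubspace_Domain)

lemma combination_adjoint:
  assumes "q \<in> A"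
  shows "q + a *\<^sub>C (u, u') + b *\<^sub>C (v, v') \<in> adjoint_op A"
  using assms A_subset_adjoint u_pair_adjoint v_pair_adjoint
  by (intro cvs.subspace_add[OF csubspace_adjoint_op] cvs.subspace_scale[OF csubspace_adjoint_op]) auto

lemma combination_H_plus:
  assumes "q \<in> A" and "(f, h) = q + a *\<^sub>C (u, u') + b *\<^sub>C (v, v')"
  shows "f \<in> H_plus A"
  using combination_adjoint[OF assms(1), of a b] unfolding assms(2)[symmetric] by (rule H_plusI)

text \<open>The \<open>q\<close> and \<open>u\<close> components belong to \<open>T\<close>, where
  \<open>B\<close> is the embedded operator; the \<open>v\<close> component alone contributes a
  multiple of \<open>\<phi>\<close>.\<close>

lemma B_eq:
  assumes "q \<in> A" and "(f, h) = q + a *\<^sub>C (u, u') + b *\<^sub>C (v, v')"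
  shows "B f y = embed A h y + 2 * \<i> * b * cnj (\<phi> v) * \<phi> y"
proof (cases "y \<in> H_plus A")
  case True
  obtain q1 q2 where q: "q = (q1, q2)" "(q1, q2) \<in> T" "q1 \<in> H_plus A"
    using assms(1) A_subset_T A_H_plus by (cases q) auto
  have fh: "f = q1 + a *\<^sub>C u + b *\<^sub>C v" "h = q2 + a *\<^sub>C u' + b *\<^sub>C v'"
    using assms(2) q(1) by (simp_all add: scaleC_prod_def)
  note sub = subspace_H_plus
  have "B f y = B q1 y + a * B u y + b * B v y"
    unfolding fh using q(3) u_H_plus v_H_plus cvs.subspace_add[OF sub] cvs.subspace_scale[OF sub]
    by (simp add: B_add B_scale)
  then show ?thesis
    using True by (simp add: B_v B_T[OF q(2)] B_T[OF u_pair_T] fh embed_def cinner_simps algebra_simps)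
next
  \<comment> \<open>Outside \<open>H_plus A\<close> every functional involved has the default value
    0.\<close>
  case False
  have "f \<in> H_plus A"
    using assms by (rule combination_H_plus)
  with False show ?thesis
    by (simp add: B_outside embed_def phi_outside)
qed

lemma phi_combination:
  assumes "q \<in> A" and "(f, h) = q + a *\<^sub>C (u, u') + b *\<^sub>C (v, v')"
  shows "\<phi> f = cnj a * \<phi> u + cnj b * \<phi> v"
proof -
  obtain q1 q2 where q: "q = (q1, q2)" "(q1, q2) \<in> A" "q1 \<in> H_plus A"
    using assms(1) A_H_plus by (cases q) auto
  have f: "f = q1 + a *\<^sub>C u + b *\<^sub>C v"
    using assms(2) q(1) by (simp add: scaleC_prod_def)
  note sub = subspace_H_plus
  show ?thesis
    unfolding f using q(3) u_H_plus v_H_plus cvs.subspace_add[OF sub] cvs.subspace_scale[OF sub]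
    by (simp add: phi_add phi_scale phi_A[OF q(2)])
qed

text \<open>The real part is \<open>B\<close> minus \<i> times the imaginary part. This halves the
  coefficient coming from \<open>v\<close> and creates one of opposite sign from
  \<open>u\<close>.\<close>

lemma rigged_Re_combination:
  assumes "q \<in> A" and fh: "(f, h) = q + a *\<^sub>C (u, u') + b *\<^sub>C (v, v')"
  shows "rigged_Re A B f y
    = embed A h y + \<i> * (b * cnj (\<phi> v) - a * cnj (\<phi> u)) * \<phi> y"
proof -
  have "f \<in> H_plus A"
    using assms by (rule combination_H_plus)
  have "rigged_Re A B f y = B f y - \<i> * rigged_Im A B f y"
    by (simp add: rigged_Re_def rigged_Im_def field_simps)
  then show ?thesis
    unfolding rigged_Im_eq[OF \<open>f \<in> H_plus A\<close>] B_eq[OF assms] phi_combination[OF assms]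
    by (simp add: algebra_simps)
qed

lemma cnj_eps: "cnj \<epsilon> = \<epsilon>"
  using eps by auto

lemma phi_u: "\<phi> u = \<epsilon> * \<phi> v"
proof -
  let ?S = "quasi_kernel A (rigged_Re A B)"
  have "cvs.subspace (Domain ?S)"
    using self_adjoint_hat by (auto simp: self_adjoint_in_def linear_operator_def intro: csubspace_Domain)
  \<comment> \<open>The factor turns the quasi-kernel vector into
    \<open>u + \<epsilon> *\<^sub>C v\<close>, because the square of \<epsilon> is 1.\<close>
  from cvs.subspace_scale[OF this gp_gm_hat, of "1 + \<epsilon> * \<kappa>"]
  have "(1 + \<epsilon> * \<kappa>) *\<^sub>C (gp - \<epsilon> *\<^sub>C gm) \<in> Domain ?S" .
  moreover have "(1 + \<epsilon> * \<kappa>) *\<^sub>C (gp - \<epsilon> *\<^sub>C gm) = u + \<epsilon> *\<^sub>C v"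
    using eps by (auto simp: u_def v_def scaleC_add_left cvs.scale_left_diff_distrib
        cvs.scale_right_diff_distrib scaleC_add_right cvs.scale_minus_left)
  ultimately obtain h where h: "(u + \<epsilon> *\<^sub>C v, h) \<in> ?S"
    by auto
  have 0: "0 \<in> A"
    using subspace_A by (rule cvs.subspace_0)
  have "(u + \<epsilon> *\<^sub>C v, u' + \<epsilon> *\<^sub>C v') \<in> adjoint_op A"
    using combination_adjoint[OF 0, of 1 \<epsilon>] by (simp add: scaleC_prod_def)
  with h hat_subset_adjoint have "h = u' + \<epsilon> *\<^sub>C v'"
    using adjoint_unique by blast
  then have "(u + \<epsilon> *\<^sub>C v, h) = 0 + 1 *\<^sub>C (u, u') + \<epsilon> *\<^sub>C (v, v')"
    by (simp add: scaleC_prod_def)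
  \<comment> \<open>The real part sends this vector to the embedded \<open>h\<close>, so the
    multiple of \<open>\<phi>\<close> must vanish; it is evaluated at \<open>v\<close>, where
    \<open>\<phi>\<close> is nonzero.\<close>
  from rigged_Re_combination[OF 0 this, of v] h
  have "(\<epsilon> * cnj (\<phi> v) - cnj (\<phi> u)) * \<phi> v = 0"
    by (simp add: quasi_kernel_def)
  then have "\<epsilon> * cnj (\<phi> v) = cnj (\<phi> u)"
    using phi_v_nonzero by simp
  then show ?thesis
    by (metis cnj_eps complex_cnj_cnj complex_cnj_mult)
qed

lemma rigged_Re_eq:
  assumes "q \<in> A" and "(f, h) = q + a *\<^sub>C (u, u') + b *\<^sub>C (v, v')"
  shows "rigged_Re A B f y = embed A h y + \<i> * (b - \<epsilon> * a) * cnj (\<phi> v) * \<phi> y"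
  unfolding rigged_Re_combination[OF assms] phi_u by (simp add: cnj_eps algebra_simps)

text \<open>\<open>\<phi>\<close> is not represented by an element of the Hilbert space, since it vanishes on \<open>A\<close>.\<close>

lemma embed_eq_phi_multiple:
  assumes "\<And>y. y \<in> H_plus A \<Longrightarrow> cinner x y = c * \<phi> y"
  shows "x = 0" and "c = 0"
proof -
  show "x = 0"
  proof (rule cinner_eq_0_dense)
    show "closure (Domain A) = UNIV"
      using densely_defined by (simp add: densely_defined_def)
    show "cinner x y = 0" if "y \<in> Domain A" for y
      using that assms[of y] phi_A A_H_plus by auto
  qed
  then show "c = 0"
    using assms[OF v_H_plus] phi_v_nonzero by simp
qed

text \<open>\<open>C\<close> stands for \<open>B\<close> or its real part, with \<alpha> and \<beta>
  the weights in the multiple of \<open>\<phi>\<close>. As \<open>adjoint_op A\<close> acts on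
  \<open>g\<close> as multiplication by \<open>z\<close>, \<open>C\<close> minus \<open>z\<close>
  sends \<open>g\<close> to (\<alpha> c + \<beta>) \<open>\<phi>\<close>; \<open>kernel\<close>
  gives uniqueness.\<close>

lemma rigged_resolvent_eq:
  assumes C: "\<And>q f h a b y. q \<in> A \<Longrightarrow> (f, h) = q + a *\<^sub>C (u, u') + b *\<^sub>C (v, v')
      \<Longrightarrow> C f y = embed A h y + (\<alpha> * a + \<beta> * b) * \<phi> y"
    and kernel: "\<And>q f a b. q \<in> A \<Longrightarrow> (f, z *\<^sub>C f) = q + a *\<^sub>C (u, u') + b *\<^sub>C (v, v')
      \<Longrightarrow> \<alpha> * a + \<beta> * b = 0 \<Longrightarrow> f = 0"
    and q: "q \<in> A" "(g, z *\<^sub>C g) = q + c *\<^sub>C (u, u') + (v, v')"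
    and nonzero: "\<alpha> * c + \<beta> \<noteq> 0"
  shows "rigged_resolvent A C z \<phi> = (1 / (\<alpha> * c + \<beta>)) *\<^sub>C g"
proof -
  define t where "t = 1 / (\<alpha> * c + \<beta>)"
  have t: "\<alpha> * (t * c) + \<beta> * t = 1"
    using nonzero by (simp add: t_def flip: add_divide_distrib)
  have tq: "t *\<^sub>C q \<in> A"
    using subspace_A q(1) by (rule cvs.subspace_scale)
  have "(t *\<^sub>C g, z *\<^sub>C t *\<^sub>C g) = t *\<^sub>C (g, z *\<^sub>C g)"
    by (simp add: scaleC_prod_def scaleC_scaleC mult.commute)
  also have "\<dots> = t *\<^sub>C q + (t * c) *\<^sub>C (u, u') + t *\<^sub>C (v, v')"
    unfolding q(2) by (simp add: scaleC_add_right scaleC_scaleC)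
  finally have tg: "(t *\<^sub>C g, z *\<^sub>C t *\<^sub>C g) = t *\<^sub>C q + (t * c) *\<^sub>C (u, u') + t *\<^sub>C (v, v')" .
  have embed_scale: "embed A (z *\<^sub>C f) y = z * embed A f y" for f y
    by (simp add: embed_def cinner_simps)
  show ?thesis
    unfolding rigged_resolvent_def t_def[symmetric]
  proof (rule the_equality)
    show "t *\<^sub>C g \<in> H_plus A \<and> (\<lambda>y. C (t *\<^sub>C g) y - z * embed A (t *\<^sub>C g) y) = \<phi>"
    proof
      show "t *\<^sub>C g \<in> H_plus A"
        using tq tg by (rule combination_H_plus)
      show "(\<lambda>y. C (t *\<^sub>C g) y - z * embed A (t *\<^sub>C g) y) = \<phi>"
        unfolding C[OF tq tg] t embed_scale by simp
    qed
  next
    fix x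
    assume x: "x \<in> H_plus A \<and> (\<lambda>y. C x y - z * embed A x y) = \<phi>"
    then obtain x' where "(x, x') \<in> adjoint_op A"
      by (auto simp: H_plus_def)
    then obtain r a b where r: "r \<in> A" "(x, x') = r + a *\<^sub>C (u, u') + b *\<^sub>C (v, v')"
      by (rule adjoint_decomposition)
    \<comment> \<open>For a second solution \<open>x\<close>, a Hilbert space vector acts as a
      multiple of \<open>\<phi>\<close>; hence both the vector and the multiple are zero.\<close>
    have "cinner (x' - z *\<^sub>C x) y = (1 - (\<alpha> * a + \<beta> * b)) * \<phi> y" if "y \<in> H_plus A" for y
    proof -
      have "C x y - z * embed A x y = \<phi> y"
        using x by metis
      then show ?thesis
        unfolding C[OF r] using that by (simp add: embed_def cinner_simps algebra_simps)
    qed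
    note * = embed_eq_phi_multiple[OF this]
    have "(x - t *\<^sub>C g, z *\<^sub>C (x - t *\<^sub>C g)) = (x, x') - (t *\<^sub>C g, z *\<^sub>C t *\<^sub>C g)"
      using *(1) by (simp add: cvs.scale_right_diff_distrib)
    also have "\<dots> = (r - t *\<^sub>C q) + (a - t * c) *\<^sub>C (u, u') + (b - t) *\<^sub>C (v, v')"
      unfolding r(2) tg by (simp only: cvs.scale_left_diff_distrib) (simp add: algebra_simps)
    finally have "x - t *\<^sub>C g = 0"
    proof (rule kernel[rotated])
      show "\<alpha> * (a - t * c) + \<beta> * (b - t) = 0"
        using *(2) t by (simp add: algebra_simps)
      show "r - t *\<^sub>C q \<in> A"
        using subspace_A r(1) tq by (rule cvs.subspace_diff)
    qed
    then show "x = t *\<^sub>C g"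
      by simp
  qed
qed

lemma phi_scaled_deficiency_element:
  assumes "q \<in> A" "(g, z *\<^sub>C g) = q + c *\<^sub>C (u, u') + (v, v')"
  shows "cnj (\<phi> (t *\<^sub>C g)) = t * (1 + \<epsilon> * c) * cnj (\<phi> v)"
proof -
  have g: "(g, z *\<^sub>C g) = q + c *\<^sub>C (u, u') + 1 *\<^sub>C (v, v')"
    using assms(2) by simp
  have "g \<in> H_plus A"
    using assms(1) g by (rule combination_H_plus)
  then show ?thesis
    by (simp add: phi_scale phi_combination[OF assms(1) g] phi_u cnj_eps algebra_simps)
qed

text \<open>The resolvent of \<open>\<phi>\<close> is \<open>g\<close> divided by 2 \<i>
  \<open>cnj (\<phi> v)\<close>. The factor \<open>cnj (\<phi> v)\<close> cancels in the channel, so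
  2 \<i> times the channel output is 1 + \<epsilon> c.\<close>

lemma transfer_value:
  assumes z: "z \<in> resolvent_set T"
    and q: "q \<in> A" "(g, z *\<^sub>C g) = q + c *\<^sub>C (u, u') + (v, v')"
  shows "1 - 2 * \<i> * channel_adjoint K (rigged_resolvent A B z (K 1)) = - \<epsilon> * c"
proof -
  let ?\<beta> = "2 * \<i> * cnj (\<phi> v)"
  have "rigged_resolvent A B z \<phi> = (1 / (0 * c + ?\<beta>)) *\<^sub>C g"
  proof (rule rigged_resolvent_eq[OF _ _ q])
    show "B f y = embed A h y + (0 * a + ?\<beta> * b) * \<phi> y"
      if "p \<in> A" "(f, h) = p + a *\<^sub>C (u, u') + b *\<^sub>C (v, v')" for p f h a b y
      using B_eq[OF that, of y] by (simp add: mult.commute mult.left_commute)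
    show "0 * c + ?\<beta> \<noteq> 0"
      using phi_v_nonzero by simp
    \<comment> \<open>Here b = 0, so \<open>f\<close> would be an eigenvector of \<open>T\<close> at
      a point of its resolvent set.\<close>
    fix p f a b
    assume p: "p \<in> A" "(f, z *\<^sub>C f) = p + a *\<^sub>C (u, u') + b *\<^sub>C (v, v')"
      and "0 * a + ?\<beta> * b = 0"
    then have "(f, z *\<^sub>C f) = p + a *\<^sub>C (u, u')"
      using phi_v_nonzero by simp
    also have "\<dots> \<in> T"
      using p(1) A_subset_T u_pair_T subspace_T by (blast intro: cvs.subspace_add cvs.subspace_scale)
    finally show "f = 0"
      using z Lambda resolvent_set_injective by (auto simp: class_Lambda_def)
  qed
  then show ?thesis
    unfolding \<phi>_def[symmetric] channel_adjoint_eq using phi_v_nonzero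
    by (simp add: phi_scaled_deficiency_element[OF q])
qed

lemma impedance_value:
  assumes "Im z \<noteq> 0"
    and q: "q \<in> A" "(g, z *\<^sub>C g) = q + c *\<^sub>C (u, u') + (v, v')"
  shows "1 - \<epsilon> * c \<noteq> 0"
    and "channel_adjoint K (rigged_resolvent A (rigged_Re A B) z (K 1))
      = (1 + \<epsilon> * c) / (\<i> * (1 - \<epsilon> * c))"
proof -
  let ?\<alpha> = "- \<i> * \<epsilon> * cnj (\<phi> v)" and ?\<beta> = "\<i> * cnj (\<phi> v)"
  have Re_eq: "rigged_Re A B f y = embed A h y + (?\<alpha> * a + ?\<beta> * b) * \<phi> y"
    if "p \<in> A" "(f, h) = p + a *\<^sub>C (u, u') + b *\<^sub>C (v, v')" for p f h a b y
    using rigged_Re_eq[OF that, of y] by (simp add: algebra_simps)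
  \<comment> \<open>Without the \<open>\<phi>\<close> term, \<open>f\<close> lies in the
    quasi-kernel, and a self-adjoint operator has no nonreal eigenvalue.\<close>
  have kernel: "f = 0"
    if "p \<in> A" "(f, z *\<^sub>C f) = p + a *\<^sub>C (u, u') + b *\<^sub>C (v, v')" "?\<alpha> * a + ?\<beta> * b = 0" for p f a b
  proof -
    have "f \<in> H_plus A"
      using that(1,2) by (rule combination_H_plus)
    moreover have "rigged_Re A B f = embed A (z *\<^sub>C f)"
      using Re_eq[OF that(1,2)] that(3) by auto
    ultimately have "(f, z *\<^sub>C f) \<in> quasi_kernel A (rigged_Re A B)"
      by (simp add: quasi_kernel_def)
    then show "f = 0"
      using self_adjoint_injective[OF self_adjoint_hat] assms(1) by blast
  qed
  \<comment> \<open>Equality would make \<open>g\<close> an eigenvector of the quasi-kernel, hence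
    zero; then \<open>(v, v')\<close> would be a combination of elements of
    \<open>T\<close>.\<close>
  show nonzero: "1 - \<epsilon> * c \<noteq> 0"
  proof
    assume "1 - \<epsilon> * c = 0"
    then have "\<epsilon> * c = 1" by simp
    then have "?\<alpha> * c + ?\<beta> * 1 = 0"
      by (simp add: algebra_simps)
    then have "g = 0"
      using kernel[OF q(1), of g c 1] q(2) by simp
    then have "(v, v') + (q + c *\<^sub>C (u, u')) = 0"
      using q(2) by (simp add: zero_prod_def add.commute)
    then have "(v, v') = - (q + c *\<^sub>C (u, u'))"
      by (rule iffD2[OF eq_neg_iff_add_eq_0])
    also have "\<dots> \<in> T"
      using q(1) A_subset_T u_pair_T subspace_T
      by (blast intro: cvs.subspace_neg cvs.subspace_add cvs.subspace_scale)
    finally show False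
      using v_pair_notin_T by blast
  qed
  have factor: "?\<alpha> * c + ?\<beta> = \<i> * (1 - \<epsilon> * c) * cnj (\<phi> v)"
    by (simp add: algebra_simps)
  then have "?\<alpha> * c + ?\<beta> \<noteq> 0"
    using nonzero phi_v_nonzero by simp
  from rigged_resolvent_eq[OF Re_eq kernel q this]
  have "rigged_resolvent A (rigged_Re A B) z \<phi> = (1 / (\<i> * (1 - \<epsilon> * c) * cnj (\<phi> v))) *\<^sub>C g"
    unfolding factor .
  then show "channel_adjoint K (rigged_resolvent A (rigged_Re A B) z (K 1))
      = (1 + \<epsilon> * c) / (\<i> * (1 - \<epsilon> * c))"
    unfolding \<phi>_def[symmetric] channel_adjoint_eq using phi_v_nonzero
    by (simp add: phi_scaled_deficiency_element[OF q])
qed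

end

section \<open>Comparison of the two systems\<close>

theorem theorem5p3:
  fixes \<Theta>\<^sub>1 \<Theta>\<^sub>2 :: "'a::complex_hilbert l_system"
    and Adot T :: "'a operator"
    and gp gm :: 'a
  assumes "minimal_l_system \<Theta>\<^sub>1" and "minimal_l_system \<Theta>\<^sub>2"
    and "sym_op \<Theta>\<^sub>1 = Adot" and "main_op \<Theta>\<^sub>1 = T"
    and "sym_op \<Theta>\<^sub>2 = Adot" and "main_op \<Theta>\<^sub>2 = T"
    and "hypothesis_I Adot T (hat_op \<Theta>\<^sub>1) gp gm"
    and "hypothesis_II Adot T (hat_op \<Theta>\<^sub>2) gp gm"
  shows "(\<forall>z. Im z > 0 \<and> z \<in> resolvent_set T \<longrightarrow>
            transfer_function \<Theta>\<^sub>1 z = - transfer_function \<Theta>\<^sub>2 z) \<and>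
         (\<forall>z. Im z > 0 \<and> z \<in> resolvent_set T \<longrightarrow>
            impedance_function \<Theta>\<^sub>2 z \<noteq> 0 \<and>
            impedance_function \<Theta>\<^sub>1 z = - 1 / impedance_function \<Theta>\<^sub>2 z)"
proof -
  have sys: "l_system \<Theta>\<^sub>1" "l_system \<Theta>\<^sub>2"
    using assms(1,2) by (simp_all add: minimal_l_system_def)
  have hyp: "hypothesis_base Adot T (hat_op \<Theta>\<^sub>1) gp gm" "gp - gm \<in> Domain (hat_op \<Theta>\<^sub>1)"
    "hypothesis_base Adot T (hat_op \<Theta>\<^sub>2) gp gm" "gp + gm \<in> Domain (hat_op \<Theta>\<^sub>2)"
    using assms(7,8) by (simp_all add: hypothesis_I_def hypothesis_II_def)
  \<comment> \<open>The condition on \<kappa> concerns only \<open>T\<close>, \<open>gp\<close> and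
    \<open>gm\<close>, so one value serves both systems.\<close>
  from hyp(1) obtain \<kappa> :: real
    where \<kappa>: "0 \<le> \<kappa>" "\<kappa> < 1" "gp - complex_of_real \<kappa> *\<^sub>C gm \<in> Domain T"
    by (auto simp: hypothesis_base_def)
  interpret dissipative_extension Adot T gp gm \<kappa>
    using sys(1) hyp(1) \<kappa> unfolding assms(3,4) l_system_def Let_def
    by unfold_locales (auto simp: assms(3,4) hypothesis_base_def maximal_dissipative_def)
  interpret s1: dissipative_system Adot T gp gm \<kappa> "state_op \<Theta>\<^sub>1" "channel \<Theta>\<^sub>1" 1
    using sys(1) hyp(1,2)
    by unfold_locales
      (auto simp: l_system_def Let_def assms(3,4) hypothesis_base_def hat_op_def)
  interpret s2: dissipative_system Adot T gp gm \<kappa> "state_op \<Theta>\<^sub>2" "channel \<Theta>\<^sub>2" "- 1"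
    using sys(2) hyp(3,4)
    by unfold_locales
      (auto simp: l_system_def Let_def assms(5,6) hypothesis_base_def hat_op_def cvs.scale_minus_left)
  have "transfer_function \<Theta>\<^sub>1 z = - transfer_function \<Theta>\<^sub>2 z \<and> impedance_function \<Theta>\<^sub>2 z \<noteq> 0 \<and>
      impedance_function \<Theta>\<^sub>1 z = - 1 / impedance_function \<Theta>\<^sub>2 z"
    if z: "Im z > 0" "z \<in> resolvent_set T" for z
  proof -
    \<comment> \<open>One deficiency element for both systems: only the sign of \<epsilon>
      distinguishes their transfer and impedance values.\<close>
    obtain q c g where q: "q \<in> Adot" "(g, z *\<^sub>C g) = q + c *\<^sub>C (u, u') + (v, v')"
      using deficiency_element[OF z(2)] .
    have "Im z \<noteq> 0"
      using z(1) by simp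
    note impedance = s1.impedance_value[OF this q] s2.impedance_value[OF this q]
    have transfer: "transfer_function \<Theta>\<^sub>1 z = - c" "transfer_function \<Theta>\<^sub>2 z = c"
      using s1.transfer_value[OF z(2) q] s2.transfer_value[OF z(2) q]
      by (simp_all add: transfer_function_def assms(3,5))
    have V: "impedance_function \<Theta>\<^sub>1 z = (1 + c) / (\<i> * (1 - c))"
      "impedance_function \<Theta>\<^sub>2 z = (1 - c) / (\<i> * (1 + c))"
      using impedance(2,4) by (simp_all add: impedance_function_def assms(3,5))
    \<comment> \<open>Each system excludes one of these zeros; together they make both quotients
      genuine and the second impedance nonzero.\<close>
    have "1 - c \<noteq> 0" "1 + c \<noteq> 0"
      using impedance(1,3) by simp_all
    then show ?thesis
      unfolding transfer V by (simp add: divide_simps)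
  qed
  then show ?thesis
    by blast
qed

end
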